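(* Let $G=(V,E)$ be an infinite graph and suppose each $v\in V$ has a list $L(v)$ of exactly three colours; let $C=\bigcup_{v\in V}L(v)$. Suppose $V=A\sqcup B$ is a partition such that $A$ is closed and $B$ is infinite. Let $h\colon A\to C$ be any list-colouring of $A$ (i.e. $h(a)\in L(a)$ for all $a\in A$), and let $x\in B$ and $c_x\in L(x)$ be arbitrary. Then there is a list-colouring $g\colon V\to C$ (i.e. $g(v)\in L(v)$ for all $v$) extending $h$ such that every vertex of $B$ is happy with $g$ and $g(x)\neq c_x$.
   Context: For a vertex $v$, $N(v)$ is its neighbourhood, $d(v)=|N(v)|$ its degree (a cardinal), and for $A\subseteq V$, $d_A(v)=|N(v)\cap A|$. A set $A\subseteq V$ is closed if every vertex $v\in V\setminus A$ satisfies $d_A(v)<d(v)$. A vertex $v$ is happy with a colouring $g$ of $G$ if at most half of the edges incident with $v$ are monochromatic, i.e. the cardinality of $\{u\in N(v): g(u)=g(v)\}$ is at most the cardinality of $\{u\in N(v): g(u)\neq g(v)\}$. *)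

theory Defs
  imports Main
begin

unbundle cardinal_syntax

definition simple_graph :: "'a set \<Rightarrow> 'a set set \<Rightarrow> bool" where
  "simple_graph V E \<longleftrightarrow> (\<forall>e\<in>E. \<exists>u\<in>V. \<exists>v\<in>V. u \<noteq> v \<and> e = {u, v})"

definition nbhd :: "'a set set \<Rightarrow> 'a \<Rightarrow> 'a set" where
  "nbhd E v = {u. {v, u} \<in> E}"

text \<open>Degrees are cardinals, represented as cardinal orders and compared with
  \<open><o\<close>; \<open>card\<close> would send every infinite degree to 0.\<close>

definition degree :: "'a set set \<Rightarrow> 'a \<Rightarrow> 'a rel" where
  "degree E v = |nbhd E v|"

definition degree_in :: "'a set set \<Rightarrow> 'a set \<Rightarrow> 'a \<Rightarrow> 'a rel" where
  "degree_in E A v = |nbhd E v \<inter> A|"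

definition closed_in :: "'a set \<Rightarrow> 'a set set \<Rightarrow> 'a set \<Rightarrow> bool" where
  "closed_in V E A \<longleftrightarrow> A \<subseteq> V \<and> (\<forall>v\<in>V - A. degree_in E A v <o degree E v)"

definition happy :: "'a set set \<Rightarrow> ('a \<Rightarrow> 'c) \<Rightarrow> 'a \<Rightarrow> bool" where
  "happy E g v \<longleftrightarrow> |{u \<in> nbhd E v. g u = g v}| \<le>o |{u \<in> nbhd E v. g u \<noteq> g v}|"

text \<open>Colourings are total functions; only their values on \<open>S\<close> matter.
  For \<open>S \<subseteq> V\<close> such a colouring automatically maps \<open>S\<close> into \<open>\<Union>v\<in>V. L v\<close>.\<close>

definition list_colouring :: "('a \<Rightarrow> 'c set) \<Rightarrow> 'a set \<Rightarrow> ('a \<Rightarrow> 'c) \<Rightarrow> bool" where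
  "list_colouring L S f \<longleftrightarrow> (\<forall>v\<in>S. f v \<in> L v)"

end

theory Submission
  imports Defs "HOL-Analysis.Product_Topology"
begin

text \<open>
  Call a vertex \<open>v\<close> of infinite degree served by \<open>u \<in> N v\<close> if \<open>u\<close> promises to avoid the colour
  of \<open>v\<close>. Since every vertex has three colours, it can keep one promise and still choose between
  two colours. So all infinite-degree vertices of \<open>B\<close> can be coloured greedily along a well-founded
  relation in which each \<open>v\<close> either has full degree to earlier vertices (one of any two colours
  then makes it happy) or is served by \<open>d(v)\<close> later ones. Such a relation exists by induction on
  \<open>|B|\<close>: an uncountable \<open>B\<close> is the union of an increasing chain of sets \<open>Y i\<close>, \<open>i \<in> B\<close>, of size
  \<open>|X i| = max |{j. j < i}| \<aleph>\<^sub>0\<close>. A vertex of degree at most \<open>|X i|\<close> has all its neighbours in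
  \<open>Y i\<close> as soon as it belongs to \<open>Y i\<close>; a vertex of larger degree gets many neighbours, one of
  which serves it, in each of the later differences up to the stage where \<open>|X i|\<close> reaches its
  degree. Vertices of finite degree come last, by compactness and minimisation of the number of
  monochromatic edges. Since \<open>x\<close> is released from its promise, it may avoid \<open>c\<^sub>x\<close> instead.
\<close>

section \<open>Arithmetic of infinite cardinals\<close>

lemma card_of_linear: "|A| \<le>o |B| \<or> |B| <o |A|"
  using card_of_ordLess[of A B] card_of_ordLeq[of A B] by argo

lemma card_of_Un_le:
  assumes "infinite X" "|A| \<le>o |X|" "|B| \<le>o |X|"
  shows "|A \<union> B| \<le>o |X|"
  using card_of_Un_ordLeq_infinite_Field[of "|X|" A B] assms
  by (metis Field_card_of card_of_Card_order)

lemma card_of_Un_ge: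
  assumes "infinite Z" "|Z| \<le>o |A \<union> B|"
  shows "|Z| \<le>o |A| \<or> |Z| \<le>o |B|"
proof (rule ccontr)
  assume "\<not> ?thesis"
  then have "|A| <o |Z|" "|B| <o |Z|" using card_of_linear by metis+
  then show False
    using card_of_Un_ordLess_infinite[OF assms(1)] not_ordLess_ordLeq assms(2) by metis
qed

lemma card_of_Un_rest:
  assumes "infinite Z" "|Z| \<le>o |A \<union> B|" "|A| <o |Z|"
  shows "|Z| \<le>o |B|"
  using card_of_Un_ge[OF assms(1,2)] not_ordLess_ordLeq[OF assms(3)] by argo

lemma card_of_subset_ordLeq: "A \<subseteq> B \<Longrightarrow> |B| \<le>o r \<Longrightarrow> |A| \<le>o r"
  by (rule ordLeq_transitive[OF card_of_mono1])

lemma card_of_subset_ordLess: "A \<subseteq> B \<Longrightarrow> |B| <o r \<Longrightarrow> |A| <o r"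
  by (rule ordLeq_ordLess_trans[OF card_of_mono1])

lemma ordLeq_card_of_superset: "r \<le>o |A| \<Longrightarrow> A \<subseteq> B \<Longrightarrow> r \<le>o |B|"
  by (rule ordLeq_transitive[OF _ card_of_mono1])

lemma card_of_subset_exists:
  assumes "|X| \<le>o |S|"
  obtains T where "T \<subseteq> S" "|T| =o |X|"
proof -
  obtain f where f: "inj_on f X" "f ` X \<subseteq> S" using assms card_of_ordLeq by metis
  then have "|X| =o |f ` X|" using card_of_ordIsoI inj_on_imp_bij_betw by metis
  then show thesis using that f(2) ordIso_symmetric by metis
qed

lemma card_of_superset:
  assumes "T \<subseteq> S" "|T| =o |X|"
  shows "|X| \<le>o |S|"
  by (rule ordIso_ordLeq_trans[OF ordIso_symmetric[OF assms(2)] card_of_mono1[OF assms(1)]])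

lemma card_of_Diff_ge:
  assumes "infinite X" "|X| <o |S|" "|M| \<le>o |X|"
  shows "|X| \<le>o |S - M|"
proof -
  have "|S| \<le>o |M \<union> (S - M)|"
    by (rule card_of_mono1) auto
  then have "\<not> |S - M| \<le>o |X|"
    using card_of_Un_le[OF assms(1,3)] assms(2) not_ordLess_ordLeq ordLeq_transitive by metis
  then show ?thesis
    using card_of_linear ordLess_imp_ordLeq by blast
qed

lemma infinite_card_gt:
  assumes "infinite X" "|X| <o |S|"
  shows "infinite S"
  using card_of_ordLeq_finite[OF ordLess_imp_ordLeq[OF assms(2)]] assms(1) by auto

lemma finite_card_less:
  assumes "finite A" "infinite B"
  shows "|A| <o |B|"
  using card_of_linear[of B A] card_of_ordLeq_finite[of B A] assms by auto

section \<open>Building a single stage of the chain\<close>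

text \<open>\<open>M\<close> is the union of the earlier stages, \<open>Q\<close> the set of vertices waiting to be served.\<close>

definition stage ::
    "('a \<Rightarrow> 'a set) \<Rightarrow> 'a set \<Rightarrow> 'a set \<Rightarrow> 'a set \<Rightarrow> 'a set \<Rightarrow> 'a set \<Rightarrow> bool" where
  "stage N B X M Q Y \<longleftrightarrow> M \<subseteq> Y \<and> Y \<subseteq> B \<and> |Y| \<le>o |X| \<and> |X| \<le>o |Y - M| \<and>
     (\<forall>v\<in>Y. |N v \<inter> B| \<le>o |X| \<longrightarrow> N v \<inter> B \<subseteq> Y) \<and>
     (\<forall>v\<in>Q. |X| <o |N v \<inter> B| \<longrightarrow> |X| \<le>o |N v \<inter> (Y - M)| )"

text \<open>Start from \<open>i\<close>, \<open>M\<close>, \<open>|X|\<close> new vertices of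
  \<open>B\<close>, and \<open>|X|\<close> new neighbours of each vertex of \<open>Q\<close> of
  large degree; these exist because removing \<open>M\<close> from a set larger than
  \<open>X\<close> leaves at least \<open>|X|\<close> elements. Then close under neighbourhoods of
  vertices of degree at most \<open>|X|\<close>. Every step is a union of at most \<open>|X|\<close>
  sets of size at most \<open>|X|\<close>, so the result stays within \<open>|X|\<close>.\<close>

lemma stage_extension:
  fixes N :: "'a \<Rightarrow> 'a set"
  assumes X: "infinite X" "|X| <o |B|"
    and M: "M \<subseteq> B" "|M| \<le>o |X|" and Q: "|Q| \<le>o |X|" and i: "i \<in> B"
  shows "\<exists>Y. i \<in> Y \<and> stage N B X M Q Y"
proof -
  have new: "\<exists>T. T \<subseteq> S - M \<and> |T| =o |X|" if "|X| <o |S|" for S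
    using card_of_Diff_ge[OF X(1) that M(2)] card_of_subset_exists by metis
  obtain T where T: "T \<subseteq> B - M" "|T| =o |X|" using new[OF X(2)] by blast
  define Q' where "Q' = {v\<in>Q. |X| <o |N v \<inter> B|}"
  have "\<forall>v\<in>Q'. \<exists>T. T \<subseteq> N v \<inter> B - M \<and> |T| =o |X|"
    using new unfolding Q'_def by blast
  then obtain t where t: "\<And>v. v \<in> Q' \<Longrightarrow> t v \<subseteq> N v \<inter> B - M" "\<And>v. v \<in> Q' \<Longrightarrow> |t v| =o |X|"
    by metis
  have "|Q'| \<le>o |X|"
    using card_of_mono1[of Q' Q] Q ordLeq_transitive unfolding Q'_def by blast
  then have tle: "|\<Union>v\<in>Q'. t v| \<le>o |X|"
    using card_of_UNION_ordLeq_infinite[OF X(1)] t(2) ordIso_imp_ordLeq by blast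
  define Y0 where "Y0 = insert i M \<union> T \<union> (\<Union>v\<in>Q'. t v)"
  \<comment> \<open>One closure step. Countably many iterations suffice: a vertex of
    \<open>Y\<close> occurs after finitely many steps, and the next step adds its whole
    neighbourhood in \<open>B\<close> if that is small.\<close>
  define h where "h Y = Y \<union> (\<Union>v\<in>{v\<in>Y. |N v \<inter> B| \<le>o |X|}. N v \<inter> B)" for Y
  have i1: "|{i}| \<le>o |X|" using X(1) card_of_singl_ordLeq by (metis finite.emptyI)
  have Y0le: "|Y0| \<le>o |X|"
    unfolding Y0_def insert_is_Un[of i M]
    by (intro card_of_Un_le X(1) M(2) tle i1 ordIso_imp_ordLeq[OF T(2)])
  have hle: "|h Y| \<le>o |X|" if "|Y| \<le>o |X|" for Y
  proof -
    have "|{v\<in>Y. |N v \<inter> B| \<le>o |X|}| \<le>o |X|"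
      using card_of_mono1[of "{v\<in>Y. |N v \<inter> B| \<le>o |X|}" Y] that ordLeq_transitive by blast
    then show ?thesis
      unfolding h_def by (intro card_of_Un_le X(1) that card_of_UNION_ordLeq_infinite) auto
  qed
  have hn: "|(h ^^ n) Y0| \<le>o |X|" for n
    by (induction n) (auto simp: Y0le hle)
  define Y where "Y = (\<Union>n. (h ^^ n) Y0)"
  have Y0Y: "Y0 \<subseteq> Y" unfolding Y_def by (metis UNIV_I UN_upper funpow_0)
  have Yle: "|Y| \<le>o |X|"
    unfolding Y_def using X(1) hn
    by (intro card_of_UNION_ordLeq_infinite) (auto simp: infinite_iff_card_of_nat)
  have hnB: "(h ^^ n) Y0 \<subseteq> B" for n
  proof (induction n)
    case 0 then show ?case using T t M(1) i unfolding Y0_def by auto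
  next
    case (Suc n) then show ?case by (auto simp: h_def)
  qed
  have cl: "N v \<inter> B \<subseteq> Y" if v: "v \<in> Y" and le: "|N v \<inter> B| \<le>o |X|" for v
  proof -
    obtain n where "v \<in> (h ^^ n) Y0" using v Y_def by auto
    then have "N v \<inter> B \<subseteq> (h ^^ Suc n) Y0" using le by (auto simp: h_def)
    then show ?thesis unfolding Y_def by blast
  qed
  have new_card: "|X| \<le>o |Y - M|"
  proof -
    have "T \<subseteq> Y - M" using T(1) Y0Y unfolding Y0_def by auto
    then show ?thesis using T(2) by (rule card_of_superset)
  qed
  have nbrs: "|X| \<le>o |N v \<inter> (Y - M)|" if "v \<in> Q" "|X| <o |N v \<inter> B|" for v
  proof -
    have "v \<in> Q'" using that unfolding Q'_def by simp
    then have "t v \<subseteq> N v \<inter> (Y - M)" "|t v| =o |X|"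
      using t[of v] Y0Y unfolding Y0_def by auto
    then show ?thesis by (rule card_of_superset)
  qed
  have MY: "M \<subseteq> Y" "i \<in> Y" using Y0Y unfolding Y0_def by auto
  have YB: "Y \<subseteq> B" unfolding Y_def using hnB by (rule UN_least)
  show ?thesis unfolding stage_def
    by (intro exI[of _ Y] conjI ballI impI MY YB Yle new_card cl nbrs)
qed

section \<open>Promise orders and the countable case\<close>

text \<open>\<open>p u = Some v\<close> is the promise of \<open>u\<close> to avoid the colour of \<open>v\<close>. The set \<open>P\<close> contains
  vertices outside \<open>B\<close> that also have to be served; it makes the induction on \<open>|B|\<close> go through.
  Only earlier neighbours of infinite degree count, as those of finite degree are coloured last.\<close>

definition promise_order ::
    "('a \<Rightarrow> 'a set) \<Rightarrow> 'a set \<Rightarrow> 'a set \<Rightarrow> ('a \<times> 'a) set \<Rightarrow> ('a \<Rightarrow> 'a option) \<Rightarrow> bool" where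
  "promise_order N B P lt p \<longleftrightarrow> wf lt \<and>
     (\<forall>u\<in>B. \<forall>v. p u = Some v \<longrightarrow> u \<in> N v \<and> (v \<in> B \<and> (v, u) \<in> lt \<or> v \<in> P)) \<and>
     (\<forall>v\<in>B. infinite (N v \<inter> B) \<longrightarrow>
        |N v \<inter> B| \<le>o |{u\<in>B. p u = Some v}| \<or>
        |N v \<inter> B| \<le>o |{u\<in>N v \<inter> B. infinite (N u \<inter> B) \<and> (u, v) \<in> lt}| ) \<and>
     (\<forall>w\<in>P. |B| \<le>o |{u\<in>B. p u = Some w}| )"

text \<open>Only countably many requests \<open>(v, n)\<close> arise, with \<open>v\<close> in
  \<open>Q\<close> and \<open>n\<close> a natural number. They are granted one by one, each time by
  a neighbour with a larger index \<open>e\<close> than \<open>v\<close> and all previous servers;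
  the neighbourhoods are infinite, so one is always left. Every \<open>v\<close> in \<open>Q\<close>
  then has infinitely many servers, which is as many as a subset of a countable \<open>B\<close> can
  require.\<close>

lemma promise_order_countable:
  fixes N :: "'a \<Rightarrow> 'a set"
  assumes B: "infinite B" "|B| \<le>o |UNIV :: nat set|" and P: "|P| \<le>o |B|"
    and NP: "\<And>w. w \<in> P \<Longrightarrow> infinite (N w \<inter> B)"
  shows "\<exists>lt p. promise_order N B P lt p"
proof -
  have "\<exists>f. inj_on f B \<and> f ` B \<subseteq> (UNIV::nat set)" using B(2) card_of_ordLeq by blast
  then obtain e :: "'a \<Rightarrow> nat" where e: "inj_on e B" by blast
  define Q where "Q = P \<union> {v\<in>B. infinite (N v \<inter> B)}"
  have Qinf: "infinite (N v \<inter> B)" if "v \<in> Q" for v using that NP unfolding Q_def by auto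
  have "|Q| \<le>o |B|" unfolding Q_def
    by (intro card_of_Un_le B(1) P card_of_mono1) auto
  then have "|Q| \<le>o |UNIV :: nat set|" using B(2) by (rule ordLeq_transitive)
  then have "|Q \<times> (UNIV :: nat set)| \<le>o |UNIV :: nat set|"
    by (intro card_of_Times_ordLeq_infinite_Field card_of_Card_order) (auto simp: Field_card_of card_of_mono1)
  then obtain c :: "'a \<times> nat \<Rightarrow> nat" where c: "inj_on c (Q \<times> (UNIV :: nat set))"
    unfolding card_of_ordLeq[symmetric] by blast
  \<comment> \<open>\<open>vv k\<close> is the vertex that makes the request with code
    \<open>k\<close>, and \<open>K\<close> is the set of codes in use.\<close>
  define vv where "vv k = fst (inv_into (Q \<times> (UNIV :: nat set)) c k)" for k
  define K where "K = c ` (Q \<times> (UNIV :: nat set))"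
  have vvQ: "vv k \<in> Q" if "k \<in> K" for k
    using inv_into_into[OF that[unfolded K_def]] unfolding vv_def by (simp add: mem_Times_iff)
  have vvc: "vv (c (v, n)) = v" if "v \<in> Q" for v n
    using that c unfolding vv_def by (simp add: inv_into_f_f)
  have big: "\<exists>u\<in>N v \<inter> B. m < e u" if "v \<in> Q" for v m
  proof -
    have "infinite (e ` (N v \<inter> B))"
      using Qinf[OF that] finite_image_iff[OF inj_on_subset[OF e]] by simp
    then show ?thesis unfolding finite_nat_set_iff_bounded_le by (auto simp: not_le)
  qed
  \<comment> \<open>\<open>f k\<close> grants request \<open>k\<close>. Strictly increasing indices
    make \<open>f\<close> injective on \<open>K\<close>, so nobody is given two promises;
    \<open>e (vv k) < e (f k)\<close> puts the server after the vertex served.\<close>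
  have "\<exists>f. \<forall>k. (k \<in> K \<longrightarrow> f k \<in> N (vv k) \<inter> B \<and> e (vv k) < e (f k) \<and> (\<forall>j<k. j \<in> K \<longrightarrow> e (f j) < e (f k)))"
  proof (rule dependent_wf_choice[OF wf_less_than, where
        P = "\<lambda>f k r. k \<in> K \<longrightarrow> r \<in> N (vv k) \<inter> B \<and> e (vv k) < e r \<and> (\<forall>j<k. j \<in> K \<longrightarrow> e (f j) < e r)"])
    fix f :: "nat \<Rightarrow> 'a" and k
    show "\<exists>r. k \<in> K \<longrightarrow> r \<in> N (vv k) \<inter> B \<and> e (vv k) < e r \<and> (\<forall>j<k. j \<in> K \<longrightarrow> e (f j) < e r)"
    proof (cases "k \<in> K")
      case True
      obtain m where m: "\<forall>x\<in>insert (e (vv k)) ((e \<circ> f) ` {..<k}). x \<le> m"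
        using finite_nat_set_iff_bounded_le[of "insert (e (vv k)) ((e \<circ> f) ` {..<k})"] by auto
      obtain r where "r \<in> N (vv k) \<inter> B" "m < e r" using big[OF vvQ[OF True]] by blast
      then show ?thesis using m by (intro exI[of _ r]) (auto intro: le_less_trans)
    qed auto
  qed auto
  then obtain f where f: "\<And>k. k \<in> K \<Longrightarrow> f k \<in> N (vv k) \<inter> B" "\<And>k. k \<in> K \<Longrightarrow> e (vv k) < e (f k)"
    "\<And>j k. k \<in> K \<Longrightarrow> j < k \<Longrightarrow> j \<in> K \<Longrightarrow> e (f j) < e (f k)" by blast
  have finj: "inj_on f K"
  proof (rule inj_onI, rule ccontr)
    fix j k assume "j \<in> K" "k \<in> K" "f j = f k" "j \<noteq> k"
    then show False using f(3)[of j k] f(3)[of k j] by (cases j k rule: linorder_cases) auto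
  qed
  define p where "p u = (if u \<in> f ` K then Some (vv (inv_into K f u)) else None)" for u
  have pf: "p (f k) = Some (vv k)" if "k \<in> K" for k
    using that finj unfolding p_def by (simp add: inv_into_f_f)
  have pinf: "infinite {u\<in>B. p u = Some v}" if v: "v \<in> Q" for v
  proof -
    have "(\<lambda>n. f (c (v, n))) ` UNIV \<subseteq> {u\<in>B. p u = Some v}"
      using pf f(1) vvc v unfolding K_def by auto
    moreover have "inj (\<lambda>n. f (c (v, n)))"
    proof (rule injI)
      fix m n assume "f (c (v, m)) = f (c (v, n))"
      then have "c (v, m) = c (v, n)" using inj_onD[OF finj] v unfolding K_def by blast
      then show "m = n" using inj_onD[OF c] v by blast
    qed
    ultimately show ?thesis
      using finite_imageD[of "\<lambda>n. f (c (v, n))" UNIV] finite_subset infinite_UNIV_nat by blast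
  qed
  have ple: "|S| \<le>o |{u\<in>B. p u = Some v}|" if "v \<in> Q" "S \<subseteq> B" for v S
  proof -
    have "|S| \<le>o |UNIV :: nat set|"
      using B(2) card_of_mono1[OF that(2)] ordLeq_transitive by blast
    then show ?thesis using pinf[OF that(1)] ordLeq_transitive[OF _ infinite_iff_card_of_nat[THEN iffD1]] by blast
  qed
  have "promise_order N B P (measure e) p"
    unfolding promise_order_def
  proof (intro conjI ballI allI impI)
    fix u v assume "u \<in> B" "p u = Some v"
    then obtain k where k: "k \<in> K" "u = f k" "v = vv k"
      using pf unfolding p_def by (auto split: if_splits)
    then show "u \<in> N v" using f(1) by auto
    show "v \<in> B \<and> (v, u) \<in> measure e \<or> v \<in> P"
      using k vvQ[OF k(1)] f(2)[OF k(1)] unfolding Q_def by auto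
  qed (use ple in \<open>auto simp: Q_def\<close>)
  then show ?thesis by blast
qed

section \<open>The chain of stages along a well-order of \<open>B\<close>\<close>

text \<open>The cardinal \<open>|B|\<close> is itself a well-order on \<open>B\<close> of least
  order type. Its strict part indexes the stages, and every proper initial segment is smaller than
  \<open>B\<close>.\<close>

definition earlier :: "'a set \<Rightarrow> 'a rel" where
  "earlier B = |B| - Id"

definition seg :: "'a set \<Rightarrow> 'a \<Rightarrow> 'a set" where
  "seg B i = {j. (j, i) \<in> earlier B}"

lemma earlier_facts:
  shows "wf (earlier B)" "trans (earlier B)"
    "i \<in> B \<Longrightarrow> j \<in> B \<Longrightarrow> i = j \<or> (i, j) \<in> earlier B \<or> (j, i) \<in> earlier B"
    "(i, j) \<in> earlier B \<Longrightarrow> i \<in> B \<and> j \<in> B"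
proof -
  have w: "well_order_on B |B|" by (rule card_of_well_order_on)
  then show "wf (earlier B)" unfolding earlier_def well_order_on_def by simp
  show "trans (earlier B)" unfolding earlier_def using w
    unfolding well_order_on_def linear_order_on_def partial_order_on_def preorder_on_def
    using trans_diff_Id by blast
  show "i = j \<or> (i, j) \<in> earlier B \<or> (j, i) \<in> earlier B" if "i \<in> B" "j \<in> B"
    using w that unfolding well_order_on_def linear_order_on_def total_on_def earlier_def by blast
  show "i \<in> B \<and> j \<in> B" if "(i, j) \<in> earlier B"
    using that Field_card_of[of B] unfolding earlier_def by (metis DiffD1 FieldI1 FieldI2)
qed

lemma card_of_seg_less:
  assumes "i \<in> B"
  shows "|seg B i| <o |B|"
proof -
  have "seg B i = underS ( |B| ) i"
    unfolding seg_def earlier_def underS_def by auto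
  then show ?thesis
    using card_of_underS[OF card_of_Card_order[of B], of i] assms by (simp add: Field_card_of)
qed

lemma wf_minimal_ex: "wf R \<Longrightarrow> x \<in> S \<Longrightarrow> \<exists>z\<in>S. \<forall>y. (y, z) \<in> R \<longrightarrow> y \<notin> S"
  unfolding wf_eq_minimal by blast

text \<open>Well-founded recursion with \<open>stage_extension\<close>. The countable set
  \<open>C\<close> keeps the bound \<open>seg B i \<union> C\<close> infinite even for the first
  indices. As \<open>P\<close> may be as large as \<open>B\<close>, its members cannot all wait from
  the beginning: \<open>w\<close> joins only after the index \<open>idx w\<close>, and injectivity
  of \<open>idx\<close> bounds the number of those waiting by \<open>|seg B i|\<close>.\<close>

lemma promise_chain:
  fixes N :: "'a \<Rightarrow> 'a set" and idx :: "'a \<Rightarrow> 'a"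
  assumes B: "|UNIV :: nat set| <o |B|" and C: "C \<subseteq> B" "|C| =o |UNIV :: nat set|"
    and idx: "inj_on idx P" "idx ` P \<subseteq> B"
  shows "\<exists>Y. \<forall>i\<in>B. i \<in> Y i \<and> |\<Union>j\<in>seg B i. Y j| \<le>o |seg B i \<union> C| \<and>
           stage N B (seg B i \<union> C) (\<Union>j\<in>seg B i. Y j)
             ((\<Union>j\<in>seg B i. Y j) \<union> {w\<in>P. idx w \<in> seg B i}) (Y i)"
proof -
  note wo = earlier_facts[where B = B]
  define \<Phi> where "\<Phi> f i y \<longleftrightarrow> (i \<in> B \<longrightarrow>
       i \<in> y \<and> |\<Union>j\<in>seg B i. f j| \<le>o |seg B i \<union> C| \<and>
       stage N B (seg B i \<union> C) (\<Union>j\<in>seg B i. f j)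
         ((\<Union>j\<in>seg B i. f j) \<union> {w\<in>P. idx w \<in> seg B i}) y)" for f i y
  have "\<exists>Y. \<forall>i. \<Phi> Y i (Y i)"
  proof (rule dependent_wf_choice[OF wo(1)])
    fix f g i r assume "\<And>z. (z, i) \<in> earlier B \<Longrightarrow> f z = (g z :: 'a set)"
    then have "(\<Union>j\<in>seg B i. f j) = (\<Union>j\<in>seg B i. g j)"
      unfolding seg_def by auto
    then show "\<Phi> f i r = \<Phi> g i r" unfolding \<Phi>_def by simp
  next
    fix i f assume IH: "\<And>j. (j, i) \<in> earlier B \<Longrightarrow> \<Phi> f j (f j)"
    show "\<exists>y. \<Phi> f i y"
    proof (cases "i \<in> B")
      case True
      define X where "X = seg B i \<union> C"
      define M where "M = (\<Union>j\<in>seg B i. f j)"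
      have Xinf: "infinite X" unfolding X_def using C(2)
        by (metis card_of_ordIso_finite finite_Un infinite_UNIV_nat)
      have "|seg B i| <o |B|" "|C| <o |B|"
        using card_of_seg_less[OF True] ordIso_ordLess_trans[OF C(2) B] by simp_all
      then have X: "|X| <o |B|"
        unfolding X_def using infinite_card_gt[OF infinite_UNIV_nat B]
        by (intro card_of_Un_ordLess_infinite)
      have j: "f j \<subseteq> B \<and> |f j| \<le>o |X|" if "j \<in> seg B i" for j
      proof -
        have "(j, i) \<in> earlier B" using that unfolding seg_def by auto
        then have "\<Phi> f j (f j)" "j \<in> B" using IH wo(4) by auto
        then have 1: "f j \<subseteq> B" "|f j| \<le>o |seg B j \<union> C|"
          unfolding \<Phi>_def stage_def by auto
        have "seg B j \<union> C \<subseteq> X"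
          unfolding X_def seg_def using \<open>(j, i) \<in> earlier B\<close> wo(2) by (auto dest: transD)
        then show ?thesis using 1(1) ordLeq_card_of_superset[OF 1(2)] by simp
      qed
      have le: "|seg B i| \<le>o |X|" unfolding X_def by (rule card_of_mono1) auto
      have M: "M \<subseteq> B" "|M| \<le>o |X|" unfolding M_def
        using j card_of_UNION_ordLeq_infinite[OF Xinf le] by auto
      have "|{w\<in>P. idx w \<in> seg B i}| \<le>o |seg B i|"
        by (rule card_of_ordLeqI[of idx]) (use idx in \<open>auto intro: inj_on_subset\<close>)
      then have "|{w\<in>P. idx w \<in> seg B i}| \<le>o |X|" using le by (rule ordLeq_transitive)
      then have Q: "|M \<union> {w\<in>P. idx w \<in> seg B i}| \<le>o |X|"
        by (rule card_of_Un_le[OF Xinf M(2)])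
      show ?thesis
        using stage_extension[OF Xinf X M Q True, of N] M(2)
        unfolding \<Phi>_def M_def[symmetric] X_def[symmetric] by auto
    qed (auto simp: \<Phi>_def)
  qed
  then show ?thesis unfolding \<Phi>_def by blast
qed

text \<open>This counts the stages at which a vertex with \<open>|Z|\<close> neighbours, waiting
  since stage \<open>i\<close>, can be served. The set \<open>J\<close> of all indices with bound
  below \<open>|Z|\<close> is either \<open>B\<close> or contains \<open>seg B j0\<close> for the
  first index \<open>j0\<close> outside it, whose bound is at least \<open>|Z|\<close>; in both
  cases \<open>|J|\<close> is at least \<open>|Z|\<close>. Discarding the indices up to
  \<open>i\<close> removes fewer than \<open>|Z|\<close> of them.\<close>

lemma card_of_initial_segment_ge:
  fixes B :: "'a set"
  assumes B: "|UNIV :: nat set| <o |B|" and C: "|C| =o |UNIV :: nat set|"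
    and Z: "Z \<subseteq> B" and i: "i \<in> B" "|seg B i \<union> C| <o |Z|"
  shows "|Z| \<le>o |{j\<in>B. i \<in> seg B j \<and> |seg B j \<union> C| <o |Z|}|"
proof -
  note wo = earlier_facts[where B = B]
  define J where "J = {j\<in>B. |seg B j \<union> C| <o |Z|}"
  have Cinf: "infinite C" using C by (metis card_of_ordIso_finite infinite_UNIV_nat)
  then have "infinite (seg B i \<union> C)" by simp
  then have Zinf: "infinite Z" using infinite_card_gt[OF _ i(2)] by simp
  have CZ: "|C| <o |Z|"
    by (rule card_of_subset_ordLess[OF _ i(2)]) simp
  have ZJ: "|Z| \<le>o |J|"
  proof (cases "J = B")
    case True show ?thesis unfolding True by (rule card_of_mono1[OF Z])
  next
    case False
    then have "B - J \<noteq> {}" unfolding J_def by auto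
    then obtain j0 where j0: "j0 \<in> B - J" "\<And>j. (j, j0) \<in> earlier B \<Longrightarrow> j \<notin> B - J"
      using wfE_min'[OF wo(1), of "B - J"] by blast
    then have "seg B j0 \<subseteq> J" unfolding seg_def using wo(4) by blast
    then have "|seg B j0| \<le>o |J|" by (rule card_of_mono1)
    moreover have "|Z| \<le>o |seg B j0 \<union> C|"
      using j0(1) card_of_linear[of Z "seg B j0 \<union> C"] unfolding J_def by auto
    then have "|Z| \<le>o |seg B j0|"
      using card_of_Un_rest[OF Zinf _ CZ] by (simp add: Un_commute)
    ultimately show ?thesis by (rule ordLeq_transitive[rotated])
  qed
  have "J \<subseteq> (seg B i \<union> {i}) \<union> {j\<in>J. i \<in> seg B j}"
    unfolding J_def seg_def using wo(3)[OF i(1)] by auto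
  then have "|Z| \<le>o |(seg B i \<union> {i}) \<union> {j\<in>J. i \<in> seg B j}|"
    by (rule ordLeq_card_of_superset[OF ZJ])
  moreover have "|seg B i \<union> {i}| <o |Z|"
  proof (rule card_of_Un_ordLess_infinite[OF Zinf])
    show "|seg B i| <o |Z|"
      by (rule card_of_subset_ordLess[OF _ i(2)]) simp
    show "|{i}| <o |Z|" using Zinf by (intro finite_card_less) simp_all
  qed
  ultimately have "|Z| \<le>o |{j\<in>J. i \<in> seg B j}|"
    by (rule card_of_Un_rest[OF Zinf])
  moreover have "{j\<in>J. i \<in> seg B j} = {j\<in>B. i \<in> seg B j \<and> |seg B j \<union> C| <o |Z|}"
    unfolding J_def by auto
  ultimately show ?thesis by simp
qed

section \<open>Existence of promise orders by induction on the cardinality\<close>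

text \<open>In the uncountable case the differences \<open>D i\<close> of the chain partition
  \<open>B\<close> and are smaller than \<open>B\<close>. The induction hypothesis is applied to
  each \<open>D i\<close>, with the vertices \<open>Q i\<close> still waiting there in the role of
  \<open>P\<close>, and the resulting orders are combined lexicographically.\<close>

lemma promise_order_exists:
  fixes N :: "'a \<Rightarrow> 'a set"
  assumes sym: "\<And>u v. u \<in> N v \<Longrightarrow> v \<in> N u"
    and "infinite B" "P \<inter> B = {}" "|P| \<le>o |B|" "\<And>w. w \<in> P \<Longrightarrow> |B| \<le>o |N w \<inter> B|"
  shows "\<exists>lt p. promise_order N B P lt p"
  using assms(2-)
proof (induction "|B|" arbitrary: B P rule: wf_induct_rule[OF wf_ordLess])
  case (1 B P)
  note IH = 1(1) and Binf = 1(2) and PB = 1(3) and P = 1(4) and NP = 1(5)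
  note wo = earlier_facts[where B = B]
  show ?case
  proof (cases "|B| \<le>o |UNIV :: nat set|")
    case True
    then show ?thesis
      using promise_order_countable[OF Binf True P] card_of_ordLeq_infinite[OF NP Binf] by simp
  next
    case False
    then have B: "|UNIV :: nat set| <o |B|" using card_of_linear by metis
    obtain C where C: "C \<subseteq> B" "|C| =o |UNIV :: nat set|"
      using card_of_subset_exists[OF ordLess_imp_ordLeq[OF B]] by blast
    obtain idx where idx: "inj_on idx P" "idx ` P \<subseteq> B" using P card_of_ordLeq by metis
    obtain Y where Y: "\<forall>i\<in>B. i \<in> Y i \<and> |\<Union>j\<in>seg B i. Y j| \<le>o |seg B i \<union> C| \<and>
           stage N B (seg B i \<union> C) (\<Union>j\<in>seg B i. Y j)
             ((\<Union>j\<in>seg B i. Y j) \<union> {w\<in>P. idx w \<in> seg B i}) (Y i)"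
      using promise_chain[OF B C idx] by blast
    define M where "M i = (\<Union>j\<in>seg B i. Y j)" for i
    define X where "X i = seg B i \<union> C" for i
    define D where "D i = Y i - M i" for i
    define Q where "Q i = {v \<in> M i \<union> {w\<in>P. idx w \<in> seg B i}. |X i| <o |N v \<inter> B|}" for i
    have YM: "M i \<subseteq> Y i" "i \<in> Y i" "Y i \<subseteq> B" "|Y i| \<le>o |X i|" "|X i| \<le>o |D i|" "|M i| \<le>o |X i|"
      and Ycl: "\<And>v. v \<in> Y i \<Longrightarrow> |N v \<inter> B| \<le>o |X i| \<Longrightarrow> N v \<inter> B \<subseteq> Y i"
      and YQ: "\<And>v. v \<in> Q i \<Longrightarrow> |X i| \<le>o |N v \<inter> D i|" if "i \<in> B" for i
      using Y[rule_format, OF that] unfolding stage_def M_def[symmetric] X_def[symmetric] D_def Q_def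
      by auto
    have Xinf: "infinite (X i)" for i unfolding X_def using C(2)
      by (metis card_of_ordIso_finite finite_Un infinite_UNIV_nat)
    have XB: "|X i| <o |B|" if "i \<in> B" for i
    proof -
      have "|seg B i| <o |B|" "|C| <o |B|"
        using card_of_seg_less[OF that] ordIso_ordLess_trans[OF C(2) B] by simp_all
      then show ?thesis
        unfolding X_def using Binf by (intro card_of_Un_ordLess_infinite)
    qed
    have YYM: "Y j \<subseteq> M i" if "(j, i) \<in> earlier B" for i j
      unfolding M_def seg_def using that by blast
    have DB: "D i \<subseteq> B" if "i \<in> B" for i using YM(3)[OF that] unfolding D_def by blast
    have Dle: "|D i| \<le>o |X i|" if "i \<in> B" for i
      unfolding D_def by (rule card_of_subset_ordLeq[OF Diff_subset YM(4)[OF that]])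
    have Ddisj: "i = j" if "u \<in> D i" "u \<in> D j" "i \<in> B" "j \<in> B" for u i j
      using wo(3)[OF that(3,4)] that(1,2) YYM unfolding D_def by blast
    have "\<exists>i\<in>B. u \<in> D i" if "u \<in> B" for u
    proof -
      have "u \<in> {i\<in>B. u \<in> Y i}" using YM(2) that by auto
      from wf_minimal_ex[OF wo(1) this]
      obtain i where i: "i \<in> {i\<in>B. u \<in> Y i}" "\<And>j. (j, i) \<in> earlier B \<Longrightarrow> j \<notin> {i\<in>B. u \<in> Y i}"
        by blast
      then have "u \<notin> M i" unfolding M_def seg_def using wo(4) by blast
      then show ?thesis using i(1) unfolding D_def by blast
    qed
    \<comment> \<open>\<open>st u\<close> is the stage at which \<open>u\<close> first
      appears.\<close>
    then obtain st where st: "\<And>u. u \<in> B \<Longrightarrow> st u \<in> B" "\<And>u. u \<in> B \<Longrightarrow> u \<in> D (st u)" by metis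
    have stD: "st u = i" if "u \<in> D i" "i \<in> B" for u i
      using Ddisj[OF that(1) st(2)] DB that st(1) by blast
    have Mst: "(st u, i) \<in> earlier B" if uM: "u \<in> M i" for u i
    proof -
      obtain j where j: "(j, i) \<in> earlier B" "u \<in> Y j" using uM unfolding M_def seg_def by blast
      then have u: "u \<in> B" "j \<in> B" using YM(3) wo(4) by blast+
      have "st u = j \<or> (st u, j) \<in> earlier B"
        using wo(3)[OF st(1)[OF u(1)] u(2)] st(2)[OF u(1)] j(2) YYM unfolding D_def by blast
      then show ?thesis using j(1) wo(2) transD by metis
    qed
    have XM: "|X j| \<le>o |X i|" if "(j, i) \<in> earlier B" for i j
      unfolding X_def seg_def by (rule card_of_mono1) (use that wo(2) in \<open>auto dest: transD\<close>)
    have "\<exists>lt p. promise_order N (D i) (Q i) lt p" if i: "i \<in> B" for i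
    proof (rule IH)
      show "( |D i|, |B| ) \<in> ordLess" by (rule ordLeq_ordLess_trans[OF Dle[OF i] XB[OF i]])
      show "infinite (D i)" by (rule card_of_ordLeq_infinite[OF YM(5)[OF i] Xinf])
      show "Q i \<inter> D i = {}" using PB DB[OF i] unfolding Q_def D_def by blast
      have "|{w\<in>P. idx w \<in> seg B i}| \<le>o |seg B i|"
        by (rule card_of_ordLeqI[of idx]) (use idx in \<open>auto intro: inj_on_subset\<close>)
      then have "|{w\<in>P. idx w \<in> seg B i}| \<le>o |X i|"
        by (rule ordLeq_card_of_superset) (simp add: X_def)
      then have "|M i \<union> {w\<in>P. idx w \<in> seg B i}| \<le>o |X i|"
        by (intro card_of_Un_le Xinf YM(6)[OF i])
      moreover have "Q i \<subseteq> M i \<union> {w\<in>P. idx w \<in> seg B i}" unfolding Q_def by blast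
      ultimately have "|Q i| \<le>o |X i|" by (rule card_of_subset_ordLeq[rotated])
      then show "|Q i| \<le>o |D i|" using YM(5)[OF i] by (rule ordLeq_transitive)
      show "\<And>w. w \<in> Q i \<Longrightarrow> |D i| \<le>o |N w \<inter> D i|"
        by (rule ordLeq_transitive[OF Dle[OF i] YQ[OF i]])
    qed
    then obtain lti q where "\<And>i. i \<in> B \<Longrightarrow> promise_order N (D i) (Q i) (lti i) (q i)" by metis
    note po = this[unfolded promise_order_def]
    \<comment> \<open>Each vertex keeps the promise assigned within its own stage; the order
      compares stages first and then uses the order inside the common stage.\<close>
    define p where "p u = q (st u) u" for u
    define lt where "lt = {(u, v). u \<in> B \<and> v \<in> B \<and>
       ((st u, st v) \<in> earlier B \<or> st u = st v \<and> (u, v) \<in> lti (st v))}"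
    have "wf lt"
    proof (rule wfI_min)
      fix u and S :: "'a set" assume u: "u \<in> S"
      show "\<exists>z\<in>S. \<forall>y. (y, z) \<in> lt \<longrightarrow> y \<notin> S"
      proof (cases "u \<in> B")
        case True
        then have "st u \<in> st ` (S \<inter> B)" using u by blast
        from wf_minimal_ex[OF wo(1) this]
        obtain i where i: "i \<in> st ` (S \<inter> B)" "\<And>j. (j, i) \<in> earlier B \<Longrightarrow> j \<notin> st ` (S \<inter> B)"
          by blast
        then obtain u' where u': "u' \<in> S \<inter> B" "st u' = i" by blast
        then have "i \<in> B" using st(1) by blast
        then have "wf (lti i)" using po by blast
        have "u' \<in> {x\<in>S \<inter> B. st x = i}" using u' by blast
        from wf_minimal_ex[OF \<open>wf (lti i)\<close> this]
        obtain z where z: "z \<in> {x\<in>S \<inter> B. st x = i}"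
          "\<And>y. (y, z) \<in> lti i \<Longrightarrow> y \<notin> {x\<in>S \<inter> B. st x = i}" by blast
        have "y \<notin> S" if "(y, z) \<in> lt" for y
          using that z i(2) unfolding lt_def by auto
        then show ?thesis using z(1) by blast
      qed (use u in \<open>auto simp: lt_def\<close>)
    qed
    moreover have "u \<in> N v \<and> (v \<in> B \<and> (v, u) \<in> lt \<or> v \<in> P)" if u: "u \<in> B" and pu: "p u = Some v" for u v
    proof -
      have 1: "u \<in> N v" "v \<in> D (st u) \<and> (v, u) \<in> lti (st u) \<or> v \<in> Q (st u)"
        using po[OF st(1)[OF u]] st(2)[OF u] pu unfolding p_def by blast+
      have "v \<in> B \<and> (v, u) \<in> lt \<or> v \<in> P"
      proof (cases "v \<in> D (st u)")
        case True
        then have "v \<notin> Q (st u)" using DB[OF st(1)[OF u]] PB unfolding Q_def D_def by blast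
        then show ?thesis
          using 1 stD[OF True st(1)[OF u]] DB[OF st(1)[OF u]] u True unfolding lt_def by auto
      next
        case False
        then have "v \<in> M (st u) \<or> v \<in> P" using 1 unfolding Q_def by blast
        moreover have "M (st u) \<subseteq> B" using YM(1,3)[OF st(1)[OF u]] by blast
        ultimately show ?thesis using Mst u unfolding lt_def by auto
      qed
      then show ?thesis using 1 by blast
    qed
    \<comment> \<open>A vertex waiting at stage \<open>j\<close> gets a server from
      \<open>D j\<close>. One per stage is enough here, and servers from different stages are
      distinct because the \<open>D j\<close> are disjoint.\<close>
    moreover have serve: "|J| \<le>o |{u\<in>B. p u = Some v}|"
      if J: "\<And>j. j \<in> J \<Longrightarrow> j \<in> B \<and> v \<in> Q j" for v J
    proof -
      have "\<exists>u\<in>D j. q j u = Some v" if "j \<in> J" for j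
      proof -
        have j: "j \<in> B" "v \<in> Q j" using J that by auto
        have "|D j| \<le>o |{u\<in>D j. q j u = Some v}|" using po[OF j(1)] j(2) by blast
        then have "infinite {u\<in>D j. q j u = Some v}"
          by (rule card_of_ordLeq_infinite[OF _ card_of_ordLeq_infinite[OF YM(5)[OF j(1)] Xinf]])
        then have "{u\<in>D j. q j u = Some v} \<noteq> {}" by (rule infinite_imp_nonempty)
        then show ?thesis by blast
      qed
      then obtain f where f: "\<And>j. j \<in> J \<Longrightarrow> f j \<in> D j" "\<And>j. j \<in> J \<Longrightarrow> q j (f j) = Some v" by metis
      show ?thesis
      proof (rule card_of_ordLeqI[of f])
        show "inj_on f J" using f(1) Ddisj J by (metis inj_onI)
        show "f j \<in> {u\<in>B. p u = Some v}" if "j \<in> J" for j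
          using f[OF that] J[OF that] DB stD unfolding p_def by auto
      qed
    qed
    moreover have "|N v \<inter> B| \<le>o |{u\<in>B. p u = Some v}| \<or>
        |N v \<inter> B| \<le>o |{u\<in>N v \<inter> B. infinite (N u \<inter> B) \<and> (u, v) \<in> lt}|"
      if v: "v \<in> B" and inf: "infinite (N v \<inter> B)" for v
    proof (cases "|N v \<inter> B| \<le>o |X (st v)|")
      \<comment> \<open>All neighbours of \<open>v\<close> in \<open>B\<close> lie in its stage, so
        \<open>d(v)\<close> of them lie in \<open>M ?i\<close> or \<open>d(v)\<close> of them lie in
        \<open>D ?i\<close>. The former are earlier than \<open>v\<close>; the latter are handled by
        the induction hypothesis.\<close>
      case small: True
      let ?i = "st v"
      have i: "?i \<in> B" "v \<in> D ?i" using st v by auto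
      have "N v \<inter> B \<subseteq> N v \<inter> M ?i \<union> N v \<inter> D ?i"
        using Ycl[OF i(1) _ small] i(2) unfolding D_def by blast
      then have "|N v \<inter> B| \<le>o |N v \<inter> M ?i| \<or> |N v \<inter> B| \<le>o |N v \<inter> D ?i|"
        by (intro card_of_Un_ge[OF inf] card_of_mono1)
      then show ?thesis
      proof
        assume le: "|N v \<inter> B| \<le>o |N v \<inter> M ?i|"
        have "u \<in> N v \<inter> B \<and> infinite (N u \<inter> B) \<and> (u, v) \<in> lt" if u: "u \<in> N v \<inter> M ?i" for u
        proof -
          have uB: "u \<in> B" using u YM(1,3)[OF i(1)] by blast
          have lu: "(st u, ?i) \<in> earlier B" using Mst u by blast
          \<comment> \<open>A neighbour \<open>u\<close> of finite degree from an earlier stage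
            would have drawn \<open>v\<close> into that stage, by closure and symmetry.\<close>
          have "infinite (N u \<inter> B)"
          proof
            assume "finite (N u \<inter> B)"
            then have "|N u \<inter> B| \<le>o |X (st u)|"
              using Xinf by (intro ordLess_imp_ordLeq finite_card_less)
            then have "N u \<inter> B \<subseteq> Y (st u)" using Ycl st uB unfolding D_def by blast
            then have "v \<in> M ?i" using sym u v YYM[OF lu] by blast
            then show False using i(2) unfolding D_def by blast
          qed
          then show ?thesis using u uB v lu unfolding lt_def by blast
        qed
        then have "N v \<inter> M ?i \<subseteq> {u\<in>N v \<inter> B. infinite (N u \<inter> B) \<and> (u, v) \<in> lt}" by blast
        then show ?thesis using ordLeq_card_of_superset[OF le] by simp
      next
        assume le: "|N v \<inter> B| \<le>o |N v \<inter> D ?i|"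
        then have "infinite (N v \<inter> D ?i)" using inf by (rule card_of_ordLeq_infinite)
        then consider "|N v \<inter> D ?i| \<le>o |{u\<in>D ?i. q ?i u = Some v}|" |
          "|N v \<inter> D ?i| \<le>o |{u\<in>N v \<inter> D ?i. infinite (N u \<inter> D ?i) \<and> (u, v) \<in> lti ?i}|"
          using po[OF i(1)] i(2) by blast
        then show ?thesis
        proof cases
          case 1
          have "{u\<in>D ?i. q ?i u = Some v} \<subseteq> {u\<in>B. p u = Some v}"
            using DB[OF i(1)] stD[OF _ i(1)] unfolding p_def by auto
          then show ?thesis using ordLeq_card_of_superset[OF ordLeq_transitive[OF le 1]] by simp
        next
          case 2
          have "{u\<in>N v \<inter> D ?i. infinite (N u \<inter> D ?i) \<and> (u, v) \<in> lti ?i}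
             \<subseteq> {u\<in>N v \<inter> B. infinite (N u \<inter> B) \<and> (u, v) \<in> lt}"
            using DB[OF i(1)] stD[OF _ i(1)] v unfolding lt_def
            by (auto dest: finite_subset[rotated, of _ "N _ \<inter> D ?i"] intro: finite_subset)
          then show ?thesis using ordLeq_card_of_superset[OF ordLeq_transitive[OF le 2]] by simp
        qed
      qed
    next
      \<comment> \<open>Now \<open>v\<close> waits at every later stage whose bound is below its
        degree, and there are at least \<open>d(v)\<close> such stages.\<close>
      case False
      then have big: "|X (st v)| <o |N v \<inter> B|" using card_of_linear by metis
      define J where "J = {j\<in>B. st v \<in> seg B j \<and> |X j| <o |N v \<inter> B|}"
      have "|N v \<inter> B| \<le>o |J|"
        using card_of_initial_segment_ge[OF B C(2), of "N v \<inter> B" "st v"] st(1)[OF v] big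
        unfolding J_def X_def by blast
      moreover have "|J| \<le>o |{u\<in>B. p u = Some v}|"
      proof (rule serve)
        fix j assume "j \<in> J"
        then have j: "j \<in> B" "(st v, j) \<in> earlier B" "|X j| <o |N v \<inter> B|"
          unfolding J_def seg_def by auto
        then show "j \<in> B \<and> v \<in> Q j"
          using YYM[OF j(2)] st(2)[OF v] unfolding Q_def D_def by blast
      qed
      ultimately show ?thesis using ordLeq_transitive by auto
    qed
    moreover have "|B| \<le>o |{u\<in>B. p u = Some w}|" if w: "w \<in> P" for w
    proof -
      have iB: "idx w \<in> B" using idx w by blast
      define J where "J = {j\<in>B. idx w \<in> seg B j \<and> |X j| <o |B|}"
      have "|B| \<le>o |J|"
        using card_of_initial_segment_ge[OF B C(2) subset_refl iB] XB[OF iB]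
        unfolding J_def X_def by blast
      moreover have "|J| \<le>o |{u\<in>B. p u = Some w}|"
        by (rule serve) (use w NP[OF w] ordLess_ordLeq_trans in \<open>auto simp: Q_def J_def\<close>)
      ultimately show ?thesis by (rule ordLeq_transitive)
    qed
    ultimately have "promise_order N B P lt p" unfolding promise_order_def by blast
    then show ?thesis by blast
  qed
qed

section \<open>Vertices of finite degree\<close>

text \<open>Tychonoff: the product of the finite discrete spaces \<open>L u\<close> is compact. The
  constraint at \<open>u\<close> reads only the finitely many coordinates in \<open>K u\<close>, so
  its solutions form a closed set, and the finite intersection property applies.\<close>

lemma finite_constraints_compactness:
  fixes L :: "'a \<Rightarrow> 'c set" and \<Phi> :: "'a \<Rightarrow> ('a \<Rightarrow> 'c) \<Rightarrow> bool"
  assumes L: "\<And>u. u \<in> F \<Longrightarrow> finite (L u)"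
    and K: "\<And>u. u \<in> F \<Longrightarrow> finite (K u)" "\<And>u. u \<in> F \<Longrightarrow> K u \<subseteq> F"
    and local: "\<And>u f g. u \<in> F \<Longrightarrow> (\<And>k. k \<in> K u \<Longrightarrow> f k = g k) \<Longrightarrow> \<Phi> u f \<Longrightarrow> \<Phi> u g"
    and fin: "\<And>F0. finite F0 \<Longrightarrow> F0 \<subseteq> F \<Longrightarrow> \<exists>f\<in>Pi\<^sub>E F L. \<forall>u\<in>F0. \<Phi> u f"
  shows "\<exists>f\<in>Pi\<^sub>E F L. \<forall>u\<in>F. \<Phi> u f"
proof -
  define T where "T = product_topology (\<lambda>u. discrete_topology (L u)) F"
  have top: "topspace T = Pi\<^sub>E F L" unfolding T_def by simp
  have comp: "compact_space T"
    unfolding T_def compact_space_product_topology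
    by (intro disjI2 ballI) (simp add: compact_space_discrete_topology L)
  define C where "C u = {f\<in>Pi\<^sub>E F L. \<Phi> u f}" for u
  have closed: "closedin T (C u)" if u: "u \<in> F" for u
  proof -
    \<comment> \<open>The box of functions that agree with \<open>h\<close> on \<open>K u\<close>.
      The solution set is a union of such boxes, finitely many because only finitely many patterns
      on \<open>K u\<close> exist.\<close>
    define cyl where "cyl h = Pi\<^sub>E F (\<lambda>k. if k \<in> K u then {h k} else L k)" for h :: "'a \<Rightarrow> 'c"
    have "C u = (\<Union>h\<in>(\<lambda>f. restrict f (K u)) ` C u. cyl h)" (is "_ = ?R")
    proof
      show "C u \<subseteq> ?R" using K(2)[OF u] by (force simp: C_def cyl_def PiE_iff)
      show "?R \<subseteq> C u"
      proof
        fix g assume "g \<in> ?R"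
        then obtain f where f: "f \<in> C u" "g \<in> cyl (restrict f (K u))" by blast
        have fg: "f k = g k" if "k \<in> K u" for k
          using PiE_mem[OF f(2)[unfolded cyl_def], of k] K(2)[OF u] that by auto
        have "\<Phi> u g" using local[of u f g] u fg f(1) unfolding C_def by blast
        moreover have "g k \<in> L k" if "k \<in> F" for k
        proof (cases "k \<in> K u")
          case True
          then show ?thesis using fg f(1) that unfolding C_def by (metis (no_types, lifting) PiE_mem mem_Collect_eq)
        next
          case False
          then show ?thesis using PiE_mem[OF f(2)[unfolded cyl_def] that] by auto
        qed
        moreover have "g \<in> extensional F" using f(2) unfolding cyl_def PiE_def by blast
        ultimately show "g \<in> C u" unfolding C_def PiE_def by blast
      qed
    qed
    moreover have "closedin T ?R"
    proof (rule closedin_Union)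
      have "(\<lambda>f. restrict f (K u)) ` C u \<subseteq> Pi\<^sub>E (K u) L"
        using K(2)[OF u] unfolding C_def by (auto simp: PiE_iff)
      moreover have "finite (Pi\<^sub>E (K u) L)" using K[OF u] L by (intro finite_PiE) auto
      ultimately show "finite (cyl ` (\<lambda>f. restrict f (K u)) ` C u)"
        using finite_subset by blast
      show "closedin T S" if S: "S \<in> cyl ` (\<lambda>f. restrict f (K u)) ` C u" for S
      proof -
        obtain f where f: "f \<in> C u" "S = cyl (restrict f (K u))" using S by blast
        have "f k \<in> L k" if "k \<in> K u" for k
          using f(1) that K(2)[OF u] unfolding C_def by (auto simp: PiE_iff)
        then show ?thesis unfolding f(2) cyl_def T_def closedin_product_topology by auto
      qed
    qed
    ultimately show ?thesis by simp
  qed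
  \<comment> \<open>The whole space is inserted so that a common point is a member of
    \<open>Pi\<^sub>E F L\<close> even if \<open>F\<close> is empty.\<close>
  have "\<Inter>(insert (Pi\<^sub>E F L) (C ` F)) \<noteq> {}"
  proof (rule compact_space_fip[THEN iffD1, OF comp, rule_format, OF conjI])
    show "\<forall>S\<in>insert (Pi\<^sub>E F L) (C ` F). closedin T S"
      using closed closedin_topspace[of T] unfolding top by blast
    show "\<forall>\<F>. finite \<F> \<and> \<F> \<subseteq> insert (Pi\<^sub>E F L) (C ` F) \<longrightarrow> \<Inter>\<F> \<noteq> {}"
    proof (intro allI impI, elim conjE)
      fix \<F> assume "finite \<F>" "\<F> \<subseteq> insert (Pi\<^sub>E F L) (C ` F)"
      then have "finite (\<F> - {Pi\<^sub>E F L})" "\<F> - {Pi\<^sub>E F L} \<subseteq> C ` F" by auto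
      then obtain F0 where F0: "finite F0" "F0 \<subseteq> F" "\<F> - {Pi\<^sub>E F L} = C ` F0"
        using finite_subset_image by metis
      obtain f where f: "f \<in> Pi\<^sub>E F L" "\<forall>u\<in>F0. \<Phi> u f" using fin[OF F0(1,2)] by blast
      have "f \<in> S" if "S \<in> \<F>" for S
      proof (cases "S = Pi\<^sub>E F L")
        case False
        then have "S \<in> \<F> - {Pi\<^sub>E F L}" using that by simp
        then have "S \<in> C ` F0" by (simp only: F0(3))
        then show ?thesis using f unfolding C_def by blast
      qed (use f in simp)
      then show "\<Inter>\<F> \<noteq> {}" by blast
    qed
  qed
  then show ?thesis unfolding C_def by auto
qed

text \<open>Take an admissible colouring with the fewest monochromatic edges meeting
  \<open>F\<close>. If \<open>v\<close> switches to another colour of its list, its new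
  monochromatic edges are among those that were not monochromatic before, and edges avoiding
  \<open>v\<close> are unaffected. Minimality therefore makes \<open>v\<close> happy.\<close>

lemma finite_set_happy:
  fixes N :: "'a \<Rightarrow> 'a set" and g0 :: "'a \<Rightarrow> 'c"
  assumes sym: "\<And>u v. u \<in> N v \<Longrightarrow> v \<in> N u" and irrefl: "\<And>v. v \<notin> N v"
    and F: "finite F" "\<And>v. v \<in> F \<Longrightarrow> finite (N v)"
    and L: "\<And>v c. v \<in> F \<Longrightarrow> \<exists>c'\<in>L v. c' \<noteq> c"
  shows "\<exists>g. (\<forall>v. v \<notin> F \<longrightarrow> g v = g0 v) \<and> (\<forall>v\<in>F. g v \<in> L v) \<and>
           (\<forall>v\<in>F. card {u\<in>N v. g u = g v} \<le> card {u\<in>N v. g u \<noteq> g v})"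
proof -
  define adm where "adm g \<longleftrightarrow> (\<forall>v. v \<notin> F \<longrightarrow> g v = g0 v) \<and> (\<forall>v\<in>F. g v \<in> L v)" for g
  \<comment> \<open>Edges are unordered pairs, so an edge with both ends in \<open>F\<close> counts
    once.\<close>
  define mono where "mono g = {e. \<exists>a\<in>F. \<exists>b\<in>N a. e = {a, b} \<and> g a = g b}" for g :: "'a \<Rightarrow> 'c"
  have fin: "finite (mono g)" for g
  proof (rule finite_subset)
    show "mono g \<subseteq> (\<Union>a\<in>F. (\<lambda>b. {a, b}) ` N a)" unfolding mono_def by blast
  qed (use F in auto)
  have "\<exists>c. v \<in> F \<longrightarrow> c \<in> L v" for v using L by blast
  then obtain l where "\<And>v. v \<in> F \<Longrightarrow> l v \<in> L v" by metis
  then have "adm (\<lambda>v. if v \<in> F then l v else g0 v)" unfolding adm_def by simp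
  then obtain g where g: "adm g" "\<And>g'. adm g' \<Longrightarrow> card (mono g) \<le> card (mono g')"
    using ex_has_least_nat[of adm _ "\<lambda>g. card (mono g)"] by blast
  have "card {u\<in>N v. g u = g v} \<le> card {u\<in>N v. g u \<noteq> g v}" if v: "v \<in> F" for v
  proof -
    obtain c where c: "c \<in> L v" "c \<noteq> g v" using L[OF v] by blast
    define g' where "g' = g(v := c)"
    have split: "card (mono k) = card {u\<in>N v. k u = k v} + card {e\<in>mono k. v \<notin> e}" for k
    proof -
      have "mono k = (\<lambda>u. {v, u}) ` {u\<in>N v. k u = k v} \<union> {e\<in>mono k. v \<notin> e}"
      proof
        show "mono k \<subseteq> (\<lambda>u. {v, u}) ` {u\<in>N v. k u = k v} \<union> {e\<in>mono k. v \<notin> e}"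
        proof
          fix e assume e: "e \<in> mono k"
          then obtain a b where ab: "a \<in> F" "b \<in> N a" "e = {a, b}" "k a = k b"
            unfolding mono_def by blast
          consider "v \<notin> e" | "v = a" | "v = b" using ab(3) by blast
          then show "e \<in> (\<lambda>u. {v, u}) ` {u\<in>N v. k u = k v} \<union> {e\<in>mono k. v \<notin> e}"
          proof cases
            case 3
            then have "e = {v, a}" "a \<in> {u\<in>N v. k u = k v}" using ab sym by auto
            then show ?thesis by blast
          qed (use e ab in auto)
        qed
        show "(\<lambda>u. {v, u}) ` {u\<in>N v. k u = k v} \<union> {e\<in>mono k. v \<notin> e} \<subseteq> mono k"
          unfolding mono_def using v by force
      qed
      moreover have "card ((\<lambda>u. {v, u}) ` {u\<in>N v. k u = k v}) = card {u\<in>N v. k u = k v}"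
        by (rule card_image) (auto simp: inj_on_def doubleton_eq_iff)
      moreover have "finite {u\<in>N v. k u = k v}" using F(2)[OF v] by simp
      moreover have "(\<lambda>u. {v, u}) ` {u\<in>N v. k u = k v} \<inter> {e\<in>mono k. v \<notin> e} = {}" by blast
      ultimately show ?thesis using card_Un_disjoint[of "(\<lambda>u. {v, u}) ` {u\<in>N v. k u = k v}"] fin[of k]
        by (metis (no_types, lifting) finite_Un)
    qed
    have "{e\<in>mono g'. v \<notin> e} = {e\<in>mono g. v \<notin> e}"
      unfolding mono_def g'_def by (rule Collect_cong) (auto; blast)
    then have "card {e\<in>mono g'. v \<notin> e} = card {e\<in>mono g. v \<notin> e}" by simp
    moreover have "card {u\<in>N v. g' u = g' v} \<le> card {u\<in>N v. g u \<noteq> g v}"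
      by (rule card_mono) (use F(2)[OF v] c irrefl in \<open>auto simp: g'_def split: if_splits\<close>)
    moreover have "adm g'" using g(1) c(1) v unfolding adm_def g'_def by auto
    ultimately show ?thesis using g(2)[of g'] split[of g] split[of g'] by linarith
  qed
  then show ?thesis using g(1) unfolding adm_def by blast
qed

section \<open>The colouring of the whole graph\<close>

text \<open>Every \<open>u\<close> avoids \<open>a\<close> or \<open>b\<close>, so \<open>S\<close>
  is the union of the two sets. This is why a choice between two colours suffices for a vertex with
  full degree to earlier ones.\<close>

lemma card_of_avoid_one_of_two:
  assumes "infinite Z" "|Z| \<le>o |S|" "a \<noteq> b"
  shows "|Z| \<le>o |{u\<in>S. f u \<noteq> a}| \<or> |Z| \<le>o |{u\<in>S. f u \<noteq> b}|"
proof (rule card_of_Un_ge[OF assms(1)])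
  show "|Z| \<le>o |{u\<in>S. f u \<noteq> a} \<union> {u\<in>S. f u \<noteq> b}|"
    by (rule ordLeq_card_of_superset[OF assms(2)]) (use assms(3) in auto)
qed

theorem theorem2:
  fixes V :: "'a set" and E :: "'a set set" and L :: "'a \<Rightarrow> 'c set"
    and A B :: "'a set" and h :: "'a \<Rightarrow> 'c" and x :: 'a and c\<^sub>x :: 'c
  assumes "simple_graph V E" and "infinite V"
    and "\<And>v. v \<in> V \<Longrightarrow> card (L v) = 3"
    and "V = A \<union> B" and "A \<inter> B = {}"
    and "closed_in V E A" and "infinite B"
    and "list_colouring L A h"
    and "x \<in> B" and "c\<^sub>x \<in> L x"
  shows "\<exists>g. list_colouring L V g \<and> (\<forall>a\<in>A. g a = h a) \<and>
             (\<forall>v\<in>B. happy E g v) \<and> g x \<noteq> c\<^sub>x"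
proof -
  note graph = assms(1) and L3 = assms(3) and V = assms(4) and AB = assms(5)
    and closed = assms(6) and Binf = assms(7) and hL = assms(8) and x = assms(9)
  define N where "N = nbhd E"
  have sym: "v \<in> N u" if "u \<in> N v" for u v
    using that unfolding N_def nbhd_def by (simp add: insert_commute)
  have irrefl: "v \<notin> N v" for v
    using graph unfolding N_def nbhd_def simple_graph_def by (auto simp: doubleton_eq_iff)
  have NV: "N v \<subseteq> A \<union> B" for v
    using graph unfolding N_def nbhd_def simple_graph_def V by (fastforce simp: doubleton_eq_iff)
  \<comment> \<open>Closedness of \<open>A\<close> leaves fewer than \<open>d(v)\<close> neighbours
    in \<open>A\<close>, so for infinite degree \<open>B\<close> contains \<open>d(v)\<close> of
    them.\<close>
  have degB: "|N v| \<le>o |N v \<inter> B|" if v: "v \<in> B" and inf: "infinite (N v)" for v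
  proof (rule card_of_Un_rest[OF inf])
    show "|N v| \<le>o |N v \<inter> A \<union> N v \<inter> B|" by (rule card_of_mono1) (use NV in blast)
    show "|N v \<inter> A| <o |N v|"
      using closed v AB unfolding closed_in_def degree_def degree_in_def N_def V by blast
  qed
  have infB: "infinite (N v \<inter> B) \<longleftrightarrow> infinite (N v)" if "v \<in> B" for v
    using degB[OF that] card_of_ordLeq_infinite by auto
  obtain lt p0 where po: "promise_order N B {} lt p0"
    using promise_order_exists[of N B "{}"] sym Binf card_of_empty by blast
  \<comment> \<open>Releasing \<open>x\<close> costs a vertex at most one server, which does not
    change an infinite cardinal bound.\<close>
  define p where "p = p0(x := None)"
  define Ev where "Ev v = {u\<in>N v \<inter> B. infinite (N u \<inter> B) \<and> (u, v) \<in> lt}" for v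
  have wf: "wf lt" using po unfolding promise_order_def by blast
  have p: "u \<in> N v" "v \<in> B" "(v, u) \<in> lt" if "u \<in> B" "p u = Some v" for u v
    using po that unfolding promise_order_def p_def by (auto split: if_splits)
  have p_or_Ev: "|N v \<inter> B| \<le>o |{u\<in>B. p u = Some v}| \<or> |N v \<inter> B| \<le>o |Ev v|"
    if v: "v \<in> B" and inf: "infinite (N v \<inter> B)" for v
  proof -
    have "|N v \<inter> B| \<le>o |{u\<in>B. p0 u = Some v}| \<or> |N v \<inter> B| \<le>o |Ev v|"
      using po v inf unfolding promise_order_def Ev_def by blast
    moreover have "|N v \<inter> B| \<le>o |{u\<in>B. p u = Some v}|" if le: "|N v \<inter> B| \<le>o |{u\<in>B. p0 u = Some v}|"
    proof (rule card_of_Un_rest[OF inf])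
      show "|N v \<inter> B| \<le>o |{x} \<union> {u\<in>B. p u = Some v}|"
        by (rule ordLeq_card_of_superset[OF le]) (auto simp: p_def)
      show "|{x}| <o |N v \<inter> B|" using inf by (intro finite_card_less) simp_all
    qed
    ultimately show ?thesis by blast
  qed
  \<comment> \<open>The colours open to \<open>v\<close> once promises are respected. As
    \<open>p x = None\<close>, at most one of the three colours is excluded:
    \<open>c\<^sub>x\<close> for \<open>x\<close>, the promised colour for any other vertex.\<close>
  define Lp where "Lp f v = {c\<in>L v. (v = x \<longrightarrow> c \<noteq> c\<^sub>x) \<and> (\<forall>w. p v = Some w \<longrightarrow> c \<noteq> f w)}"
    for f :: "'a \<Rightarrow> 'c" and v
  have Lp2: "\<exists>a\<in>Lp f v. \<exists>b\<in>Lp f v. a \<noteq> b" if v: "v \<in> B" for f v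
  proof -
    obtain d where d: "L v - {d} \<subseteq> Lp f v"
    proof (cases "v = x")
      case True
      then have "L v - {c\<^sub>x} \<subseteq> Lp f v" unfolding Lp_def p_def by auto
      then show thesis by (rule that)
    next
      case False
      then have "L v - {f (the (p v))} \<subseteq> Lp f v" unfolding Lp_def by auto
      then show thesis by (rule that)
    qed
    obtain a b c where "L v = {a, b, c}" "a \<noteq> b" "a \<noteq> c" "b \<noteq> c"
      using L3[of v] v V by (auto simp: card_3_iff)
    then show ?thesis using d by (cases "d = a"; cases "d = b") auto
  qed
  \<comment> \<open>The greedy rule for \<open>v\<close> consults \<open>f\<close> only at vertices
    before \<open>v\<close>: the one it made its promise to and those in
    \<open>Ev v\<close>.\<close>
  define \<Phi> where "\<Phi> f v c \<longleftrightarrow> (v \<in> B \<longrightarrow> c \<in> Lp f v \<and>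
      (infinite (N v \<inter> B) \<longrightarrow> |N v \<inter> B| \<le>o |Ev v| \<longrightarrow> |N v \<inter> B| \<le>o |{u\<in>Ev v. f u \<noteq> c}| ))"
    for f :: "'a \<Rightarrow> 'c" and v c
  have "\<exists>g. \<forall>v. \<Phi> g v (g v)"
  proof (rule dependent_wf_choice[OF wf])
    fix f g :: "'a \<Rightarrow> 'c" and v c
    assume fg: "\<And>u. (u, v) \<in> lt \<Longrightarrow> f u = g u"
    have "Lp f v = Lp g v" if "v \<in> B" using fg p(3)[OF that] unfolding Lp_def by auto
    moreover have "{u\<in>Ev v. f u \<noteq> c} = {u\<in>Ev v. g u \<noteq> c}" using fg unfolding Ev_def by auto
    ultimately show "\<Phi> f v c = \<Phi> g v c" unfolding \<Phi>_def by auto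
  next
    fix v and f :: "'a \<Rightarrow> 'c"
    show "\<exists>c. \<Phi> f v c"
    proof (cases "v \<in> B")
      case True
      then obtain a b where ab: "a \<in> Lp f v" "b \<in> Lp f v" "a \<noteq> b" using Lp2 by blast
      show ?thesis
      proof (cases "infinite (N v \<inter> B) \<and> |N v \<inter> B| \<le>o |Ev v|")
        case True
        then show ?thesis using card_of_avoid_one_of_two[OF _ _ ab(3), of "N v \<inter> B" "Ev v" f] ab
          unfolding \<Phi>_def by auto
      next
        case False
        then show ?thesis using ab(1) unfolding \<Phi>_def by auto
      qed
    qed (simp add: \<Phi>_def)
  qed
  then obtain g1 where "\<And>v. \<Phi> g1 v (g1 v)" by blast
  then have g1: "\<And>v. v \<in> B \<Longrightarrow> g1 v \<in> Lp g1 v"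
    "\<And>v. v \<in> B \<Longrightarrow> infinite (N v \<inter> B) \<Longrightarrow> |N v \<inter> B| \<le>o |Ev v| \<Longrightarrow>
        |N v \<inter> B| \<le>o |{u\<in>Ev v. g1 u \<noteq> g1 v}|"
    unfolding \<Phi>_def by auto
  \<comment> \<open>On \<open>F\<close> the values of \<open>g1\<close> are provisional. Those on
    vertices of \<open>B\<close> of infinite degree are final, so promises to these vertices survive
    when \<open>F\<close> is recoloured from the lists \<open>Lp g1\<close>.\<close>
  define g2 where "g2 v = (if v \<in> A then h v else g1 v)" for v
  define F where "F = {v\<in>B. finite (N v)}"
  define ext where "ext f u = (if u \<in> F then f u else g2 u)" for f :: "'a \<Rightarrow> 'c" and u
  define ok where "ok v f \<longleftrightarrow> card {u\<in>N v. ext f u = ext f v} \<le> card {u\<in>N v. ext f u \<noteq> ext f v}"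
    for v f
  have "\<exists>f\<in>Pi\<^sub>E F (Lp g1). \<forall>v\<in>F. ok v f"
  proof (rule finite_constraints_compactness[where K = "\<lambda>v. insert v (N v \<inter> F)"])
    fix u assume u: "u \<in> F"
    then have "finite (L u)" using L3[of u] V unfolding F_def by (auto intro: card_ge_0_finite)
    then show "finite (Lp g1 u)" unfolding Lp_def by simp
    show "finite (insert u (N u \<inter> F))" "insert u (N u \<inter> F) \<subseteq> F" using u unfolding F_def by auto
    fix f g :: "'a \<Rightarrow> 'c" assume fg: "\<And>k. k \<in> insert u (N u \<inter> F) \<Longrightarrow> f k = g k" and "ok u f"
    have "ext f k = ext g k" if "k \<in> insert u (N u)" for k
      using that fg u unfolding ext_def by auto
    then have "{w\<in>N u. ext f w = ext f u} = {w\<in>N u. ext g w = ext g u}"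
      "{w\<in>N u. ext f w \<noteq> ext f u} = {w\<in>N u. ext g w \<noteq> ext g u}" by auto
    then show "ok u g" using \<open>ok u f\<close> unfolding ok_def by simp
  next
    fix F0 assume F0: "finite F0" "F0 \<subseteq> F"
    obtain l where l: "\<And>v. v \<in> F \<Longrightarrow> l v \<in> Lp g1 v" using g1(1) unfolding F_def by blast
    have other: "\<exists>c'\<in>Lp g1 v. c' \<noteq> c" if "v \<in> F0" for v c
    proof -
      have "v \<in> B" using that F0(2) unfolding F_def by blast
      then obtain a b where "a \<in> Lp g1 v" "b \<in> Lp g1 v" "a \<noteq> b" using Lp2 by blast
      then show ?thesis by (cases "a = c") auto
    qed
    have "finite (N v)" if "v \<in> F0" for v using that F0(2) unfolding F_def by blast
    from finite_set_happy[of N F0 "Lp g1" "ext l", OF sym irrefl F0(1) this other]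
    obtain g where g: "\<And>v. v \<notin> F0 \<Longrightarrow> g v = ext l v" "\<And>v. v \<in> F0 \<Longrightarrow> g v \<in> Lp g1 v"
      "\<And>v. v \<in> F0 \<Longrightarrow> card {u\<in>N v. g u = g v} \<le> card {u\<in>N v. g u \<noteq> g v}"
      by blast
    have "ext (restrict g F) = g"
    proof
      show "ext (restrict g F) v = g v" for v
      proof (cases "v \<in> F")
        case False
        then have "v \<notin> F0" using F0(2) by blast
        then show ?thesis using g(1)[of v] False by (simp add: ext_def)
      qed (simp add: ext_def)
    qed
    then have "\<forall>u\<in>F0. ok u (restrict g F)" using g(3) unfolding ok_def by simp
    moreover have "g v \<in> Lp g1 v" if "v \<in> F" for v
      using g(1)[of v] g(2)[of v] l[OF that] that by (cases "v \<in> F0") (simp_all add: ext_def)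
    then have "restrict g F \<in> Pi\<^sub>E F (Lp g1)" by auto
    ultimately show "\<exists>f\<in>Pi\<^sub>E F (Lp g1). \<forall>u\<in>F0. ok u f" by blast
  qed
  then obtain f where f: "f \<in> Pi\<^sub>E F (Lp g1)" "\<And>v. v \<in> F \<Longrightarrow> ok v f" by blast
  define g where "g = ext f"
  have gF: "g v \<in> Lp g1 v" if "v \<in> B" for v
  proof (cases "v \<in> F")
    case True
    then show ?thesis using PiE_mem[OF f(1)] unfolding g_def ext_def by simp
  next
    case False
    then show ?thesis using g1(1)[OF that] that AB unfolding g_def ext_def g2_def by auto
  qed
  have gI: "g v = g1 v" if "v \<in> B" "infinite (N v)" for v
    using that AB unfolding g_def ext_def g2_def F_def by auto
  have gA: "g a = h a" if "a \<in> A" for a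
    using that AB unfolding g_def ext_def g2_def F_def by auto
  have "happy E g v" if v: "v \<in> B" for v
  proof (cases "finite (N v)")
    case True
    then have "card {u\<in>N v. g u = g v} \<le> card {u\<in>N v. g u \<noteq> g v}"
      using f(2)[of v] v unfolding ok_def F_def g_def by blast
    then show ?thesis unfolding happy_def N_def[symmetric] card_of_ordLeq[symmetric]
      using True inj_on_iff_card_le[of "{u\<in>N v. g u = g v}" "{u\<in>N v. g u \<noteq> g v}"] by simp
  next
    case False
    then have inf: "infinite (N v \<inter> B)" using infB[OF v] by simp
    have "|N v \<inter> B| \<le>o |{u\<in>N v. g u \<noteq> g v}|"
      using p_or_Ev[OF v inf]
    proof
      assume le: "|N v \<inter> B| \<le>o |{u\<in>B. p u = Some v}|"
      \<comment> \<open>A server, of finite or infinite degree, has a colour in \<open>Lp g1\<close>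
        and so differs from \<open>g1 v\<close>, the final colour of \<open>v\<close>.\<close>
      have "{u\<in>B. p u = Some v} \<subseteq> {u\<in>N v. g u \<noteq> g v}"
        using gF p(1) gI[OF v False] unfolding Lp_def by fastforce
      then show ?thesis by (rule ordLeq_card_of_superset[OF le])
    next
      assume "|N v \<inter> B| \<le>o |Ev v|"
      then have le: "|N v \<inter> B| \<le>o |{u\<in>Ev v. g1 u \<noteq> g1 v}|" by (rule g1(2)[OF v inf])
      \<comment> \<open>Vertices of \<open>Ev v\<close> have infinite degree, so their colours are
        still those of \<open>g1\<close>.\<close>
      have "{u\<in>Ev v. g1 u \<noteq> g1 v} \<subseteq> {u\<in>N v. g u \<noteq> g v}"
        using gI[OF v False] gI infB unfolding Ev_def by auto
      then show ?thesis by (rule ordLeq_card_of_superset[OF le])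
    qed
    then have "|N v| \<le>o |{u\<in>N v. g u \<noteq> g v}|"
      by (rule ordLeq_transitive[OF degB[OF v False]])
    then show ?thesis unfolding happy_def N_def[symmetric]
      by (rule card_of_subset_ordLeq[rotated]) simp
  qed
  moreover have "list_colouring L V g"
    using hL gA gF unfolding list_colouring_def V Lp_def by auto
  moreover have "g x \<noteq> c\<^sub>x" using gF[OF x] unfolding Lp_def by simp
  ultimately show ?thesis using gA by blast
qed

end
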